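(* Let $V\subset\mathbb{Z}^n$ be finite with $0\in V$, and let $Q_V(x_1,\dots,x_n)=\sum_{(a_1,\dots,a_n)\in -V}x_1^{a_1}\cdots x_n^{a_n}$ (a Laurent polynomial). If there is a tiling of $\mathbb{Z}^n$ by translates of $V$, then there exists $(x_1,\dots,x_n)\in(\mathbb{C}\setminus\{0\})^n$ such that $Q_V(x_1^a,\dots,x_n^a)=0$ simultaneously for all integers $a$ relatively prime to $|V|$.
   Context: A tiling of $\mathbb{Z}^n$ by translates of $V$ is a family $\{V+l: l\in\mathcal{L}\}$, $\mathcal{L}\subset\mathbb{Z}^n$, such that every $x\in\mathbb{Z}^n$ can be written uniquely as $x=v+l$ with $v\in V$, $l\in\mathcal{L}$.
   Formalization: The case V = {0} is excluded (so |V| ≥ 2): there V tiles Z^n with L = Z^n, but Q_V is the constant 1 and has no zero, so the claim as written fails. *)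

theory Defs
  imports "HOL-Analysis.Analysis"
begin

definition is_tiling :: "(int ^ 'n) set \<Rightarrow> (int ^ 'n) set \<Rightarrow> bool" where
  "is_tiling V L \<longleftrightarrow> (\<forall>x. \<exists>!(v, l). v \<in> V \<and> l \<in> L \<and> x = v + l)"

text \<open>Values of the Laurent polynomial; meaningful at points with all coordinates nonzero.
  The exponents range over \<open>-V\<close>, which is pointwise negation, not set complement.\<close>

definition Q :: "(int ^ 'n) set \<Rightarrow> complex ^ 'n \<Rightarrow> complex" where
  "Q V x = (\<Sum>a \<in> uminus ` V. \<Prod>i\<in>UNIV. (x $ i) powi (a $ i))"

end

theory Submission
  imports Defs "HOL-Library.Poly_Mapping" "HOL-Number_Theory.Residues"
begin

text \<open>
  Let \<open>f\<close> be the indicator of \<open>L\<close> and \<open>k = card V\<close>. For \<open>a\<close> coprime to \<open>k\<close>, the dilated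
  tile \<open>a V\<close> still tiles with \<open>L\<close> outside a set of density zero: if \<open>p\<close> is a prime not dividing
  \<open>k\<close>, then in the group ring \<open>p V\<close> is congruent to the \<open>p\<close>-th power of \<open>V\<close> modulo \<open>p\<close>, so
  \<open>p V\<close> covers almost every point \<open>k ^ (p - 1) = 1\<close> (mod \<open>p\<close>) times, hence at least once, while
  the average number of coverings is 1.

  Therefore the convolution of \<open>g = f - 1/k\<close> with \<open>a V\<close> vanishes almost everywhere, whereas
  \<open>\<bar>g\<bar> \<ge> 1/k\<close> everywhere. Truncating \<open>g\<close> to a large cube and applying Parseval's identity over roots
  of unity yields, for every finite set of values \<open>a\<close>, a point of the unit torus at which all the
  corresponding values of \<open>Q\<close> are arbitrarily small, and compactness gives a common zero. On the torus
  the exponents \<open>a\<close> and \<open>- a\<close> give complex conjugate values, so only \<open>a > 0\<close> matters.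
\<close>

section \<open>The Frobenius congruence in the group ring\<close>

text \<open>The prime p divides every intermediate binomial coefficient. An explicit multiple of
  \<open>of_nat p\<close> expresses the congruence, so it can be applied inside the group
  ring.\<close>

lemma prime_power_add_cong:
  fixes x y :: "'a :: comm_ring_1"
  assumes "prime p"
  shows "\<exists>c. (x + y) ^ p = x ^ p + y ^ p + of_nat p * c"
proof -
  have p: "p > 1" using assms prime_gt_1_nat by blast
  let ?t = "\<lambda>k. of_nat (p choose k) * x ^ k * y ^ (p - k)"
  have "(x + y) ^ p = (\<Sum>k\<le>p. ?t k)" by (rule binomial_ring)
  also have "{..p} = insert 0 (insert p {0<..<p})" using p by auto
  also have "sum ?t \<dots> = x ^ p + y ^ p + (\<Sum>k\<in>{0<..<p}. ?t k)"
    using p by (simp add: add_ac)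
  also have "(\<Sum>k\<in>{0<..<p}. ?t k)
      = (\<Sum>k\<in>{0<..<p}. of_nat p * (of_nat ((p choose k) div p) * x ^ k * y ^ (p - k)))"
  proof (rule sum.cong)
    fix k assume "k \<in> {0<..<p}"
    then have "p dvd p choose k" using assms by (intro dvd_choose_prime) auto
    then have "of_nat (p choose k) = (of_nat p * of_nat ((p choose k) div p) :: 'a)"
      by (metis dvd_mult_div_cancel of_nat_mult)
    then show "?t k = of_nat p * (of_nat ((p choose k) div p) * x ^ k * y ^ (p - k))"
      by (simp add: mult_ac)
  qed simp
  also have "\<dots> = of_nat p * (\<Sum>k\<in>{0<..<p}. of_nat ((p choose k) div p) * x ^ k * y ^ (p - k))"
    by (simp add: sum_distrib_left)
  finally show ?thesis by blast
qed

lemma prime_power_sum_cong: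
  fixes y :: "'b \<Rightarrow> 'a :: comm_ring_1"
  assumes "prime p" "finite A"
  shows "\<exists>c. (\<Sum>i\<in>A. y i) ^ p = (\<Sum>i\<in>A. y i ^ p) + of_nat p * c"
  using assms(2)
proof (induction A rule: finite_induct)
  case empty
  show ?case using prime_gt_0_nat[OF assms(1)] by (intro exI[of _ 0]) (simp add: power_0_left)
next
  case (insert a A)
  then obtain c where c: "(\<Sum>i\<in>A. y i) ^ p = (\<Sum>i\<in>A. y i ^ p) + of_nat p * c" by blast
  obtain d where "(y a + (\<Sum>i\<in>A. y i)) ^ p = y a ^ p + (\<Sum>i\<in>A. y i) ^ p + of_nat p * d"
    using prime_power_add_cong[OF assms(1)] by blast
  then show ?case using insert c
    by (intro exI[of _ "c + d"]) (simp add: algebra_simps)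
qed

text \<open>The finitely supported maps form the group ring of the group, with
  \<open>frag_of v\<close> as the point mass at v. The ring acts here on functions of arbitrary
  support, such as the indicator of an infinite set of translations.\<close>

definition convolve :: "('g :: ab_group_add \<Rightarrow>\<^sub>0 int) \<Rightarrow> ('g \<Rightarrow> int) \<Rightarrow> 'g \<Rightarrow> int" where
  "convolve P f x = (\<Sum>u\<in>Poly_Mapping.keys P. Poly_Mapping.lookup P u * f (x - u))"

lemma convolve_zero [simp]: "convolve 0 f x = 0"
  by (simp add: convolve_def)

lemma convolve_single [simp]: "convolve (Poly_Mapping.single u c) f x = c * f (x - u)"
  by (simp add: convolve_def)

lemma convolve_add: "convolve (P + R) f x = convolve P f x + convolve R f x"
  unfolding convolve_def
  by (rule setsum_keys_plus_distrib) (auto simp: algebra_simps)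

lemma convolve_sum: "convolve (\<Sum>i\<in>A. P i) f x = (\<Sum>i\<in>A. convolve (P i) f x)"
  by (induction A rule: infinite_finite_induct) (auto simp: convolve_add)

lemma convolve_of_nat_mult: "convolve (of_nat n * P) f x = int n * convolve P f x"
  by (induction n) (auto simp: convolve_add algebra_simps)

text \<open>Multiplying by a point mass translates. With additivity, this turns powers in the group
  ring into iterated sums of translates.\<close>

lemma convolve_frag_of_mult: "convolve (frag_of v * P) f x = convolve P f (x - v)"
proof (induction P rule: update_induct)
  case const
  then show ?case by simp
next
  case (update P a b)
  \<comment> \<open>The induction only updates at a point outside the support, so the update is a
    sum.\<close>
  have "Poly_Mapping.update a b P = P + Poly_Mapping.single a b"
    using update by (intro poly_mapping_eqI)
      (auto simp: lookup_add Poly_Mapping.update.rep_eq lookup_single when_def in_keys_iff)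
  then show ?case using update
    by (simp add: algebra_simps convolve_add mult_single)
qed

lemma frag_of_power: "frag_of v ^ n = frag_of (of_nat n *s v)"
  for v :: "int ^ 'n"
  by (induction n) (simp_all add: mult_single algebra_simps flip: single_one)

text \<open>For f the indicator of L this counts the v in V with x - a v in L, that is, how often
  the dilated tile covers x.\<close>

definition hits :: "(int ^ 'n) set \<Rightarrow> (int ^ 'n \<Rightarrow> int) \<Rightarrow> int \<Rightarrow> int ^ 'n \<Rightarrow> int" where
  "hits V f a x = (\<Sum>v\<in>V. f (x - a *s v))"

text \<open>Modulo p, the p-th power of a sum of point masses is the sum of their p-th powers, and
  the p-th power of the point mass at a v is the one at p a v.\<close>

lemma hits_prime_cong:
  assumes "finite V" "prime p"
  shows "[hits V f (int p * a) x = convolve ((\<Sum>v\<in>V. frag_of (a *s v)) ^ p) f x] (mod int p)"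
proof -
  obtain R where R: "(\<Sum>v\<in>V. frag_of (a *s v)) ^ p
      = (\<Sum>v\<in>V. frag_of (a *s v) ^ p) + of_nat p * R"
    using prime_power_sum_cong[OF assms(2,1)] by blast
  have "convolve ((\<Sum>v\<in>V. frag_of (a *s v)) ^ p) f x = hits V f (int p * a) x + int p * convolve R f x"
    unfolding R
    by (simp add: convolve_add convolve_sum convolve_of_nat_mult frag_of_power hits_def)
  then show ?thesis by (simp add: cong_def)
qed

lemma convolve_power_Suc:
  "convolve ((\<Sum>v\<in>V. frag_of (a *s v)) ^ Suc m) f x
    = (\<Sum>v\<in>V. convolve ((\<Sum>v\<in>V. frag_of (a *s v)) ^ m) f (x - a *s v))"
  by (simp add: sum_distrib_right convolve_sum convolve_frag_of_mult)

section \<open>Averages over cubes\<close>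

lemma bij_betw_vec_lambda_PiE:
  "bij_betw vec_lambda (\<Pi>\<^sub>E i\<in>UNIV. A i) {x :: 'a ^ 'n. \<forall>i. x $ i \<in> A i}"
  by (rule bij_betw_byWitness[where f' = vec_nth]) (auto simp: vec_lambda_inverse)

lemma finite_vec_box:
  assumes "\<And>i. finite (A i)"
  shows "finite {x :: 'a ^ 'n. \<forall>i. x $ i \<in> A i}"
  using bij_betw_finite[OF bij_betw_vec_lambda_PiE[of A]] assms by (simp add: finite_PiE)

lemma card_vec_box: "card {x :: 'a ^ 'n. \<forall>i. x $ i \<in> A i} = (\<Prod>i\<in>UNIV. card (A i))"
  using bij_betw_same_card[OF bij_betw_vec_lambda_PiE[of A]] by (simp add: card_PiE)

lemma mem_plus_image_iff: "y \<in> (+) u ` A \<longleftrightarrow> y - u \<in> A" for u :: "'a :: ab_group_add"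
  by (auto simp: image_iff intro!: bexI[of _ "y - u"])

definition cube :: "nat \<Rightarrow> (int ^ 'n) set" where
  "cube N = {x. \<forall>i. x $ i \<in> {0..<int N}}"

lemma finite_cube [simp]: "finite (cube N)"
  unfolding cube_def by (rule finite_vec_box) simp

lemma card_cube: "card (cube N :: (int ^ 'n) set) = N ^ CARD('n)"
  unfolding cube_def by (simp only: card_vec_box) simp

text \<open>These are the points where replacing the cube by its translate makes a difference, hence
  the error set of every shift.\<close>

definition cube_boundary :: "int ^ 'n \<Rightarrow> nat \<Rightarrow> (int ^ 'n) set" where
  "cube_boundary u N = sym_diff ((+) u ` cube N) (cube N)"

lemma finite_cube_boundary [simp]: "finite (cube_boundary u N)"
  by (simp add: cube_boundary_def)

text \<open>Cubes form a Folner sequence: a cube and its translate overlap in a box with sides N -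
  |u_i|, whose share of the cube tends to 1.\<close>

lemma cube_boundary_density:
  fixes u :: "int ^ 'n"
  shows "(\<lambda>N. real (card (cube_boundary u N)) / real N ^ CARD('n)) \<longlonglongrightarrow> 0"
proof -
  \<comment> \<open>From K on, no side N - |u_i| is negative; the extra 1 also keeps N
    positive.\<close>
  define K :: nat where "K = nat (\<Sum>i\<in>UNIV. \<bar>u $ i\<bar>) + 1"
  have K: "\<bar>u $ i\<bar> \<le> int K" for i
    using member_le_sum[of i UNIV "\<lambda>i. \<bar>u $ i\<bar>"] by (simp add: K_def)
  \<comment> \<open>The factor 2 arises because both one-sided differences have the size of the cube
    minus the overlap.\<close>
  let ?r = "\<lambda>N. 2 * (1 - (\<Prod>i\<in>UNIV. (1 - real_of_int \<bar>u $ i\<bar> / real N)))"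
  have "real (card (cube_boundary u N)) / real N ^ CARD('n) = ?r N" if N: "N \<ge> K" for N
  proof -
    have N0: "N > 0" using N by (simp add: K_def)
    let ?A = "(+) u ` cube N" and ?B = "cube N :: (int ^ 'n) set"
    have mem: "x \<in> ?A \<longleftrightarrow> (\<forall>i. x $ i \<in> {u $ i..<int N + u $ i})" for x
      unfolding mem_plus_image_iff by (auto simp: cube_def algebra_simps)
    have "?A \<inter> ?B = {x. \<forall>i. x $ i \<in> {max 0 (u $ i)..<min (int N) (int N + u $ i)}}"
      by (simp add: set_eq_iff mem) (auto simp: cube_def)
    then have "card (?A \<inter> ?B) = (\<Prod>i\<in>UNIV. nat (min (int N) (int N + u $ i) - max 0 (u $ i)))"
      by (simp only: card_vec_box card_atLeastLessThan_int)
    also have "real \<dots> = (\<Prod>i\<in>UNIV. real N - real_of_int \<bar>u $ i\<bar>)"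
    proof -
      have "real (nat (min (int N) (int N + u $ i) - max 0 (u $ i))) = real N - real_of_int \<bar>u $ i\<bar>" for i
      proof -
        have "min (int N) (int N + u $ i) - max 0 (u $ i) = int N - \<bar>u $ i\<bar>" by linarith
        then show ?thesis using K[of i] N by (simp add: of_nat_nat)
      qed
      then show ?thesis by simp
    qed
    finally have I: "real (card (?A \<inter> ?B)) = (\<Prod>i\<in>UNIV. real N - real_of_int \<bar>u $ i\<bar>)" .
    have cA: "card ?A = N ^ CARD('n)" by (simp add: card_image card_cube)
    have "card (cube_boundary u N) = card (?A - ?B) + card (?B - ?A)"
      unfolding cube_boundary_def by (rule card_Un_disjoint) auto
    moreover have "card ?A = card (?A - ?B) + card (?A \<inter> ?B)"
      using card_Diff_subset_Int[of ?A ?B] card_mono[of ?A "?A \<inter> ?B"] by simp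
    moreover have "card ?B = card (?B - ?A) + card (?A \<inter> ?B)"
      using card_Diff_subset_Int[of ?B ?A] card_mono[of ?B "?A \<inter> ?B"] by (simp add: Int_commute)
    ultimately have "real (card (cube_boundary u N)) = 2 * (real N ^ CARD('n) - real (card (?A \<inter> ?B)))"
      using cA card_cube[where 'n='n, of N] by (simp flip: of_nat_power)
    also have "\<dots> / real N ^ CARD('n) = 2 * (1 - real (card (?A \<inter> ?B)) / real N ^ CARD('n))"
      using N0 by (simp add: field_simps)
    also have "real (card (?A \<inter> ?B)) / real N ^ CARD('n)
        = (\<Prod>i\<in>UNIV. (real N - real_of_int \<bar>u $ i\<bar>) / real N)"
      by (simp add: I prod_dividef)
    also have "\<dots> = (\<Prod>i\<in>UNIV. 1 - real_of_int \<bar>u $ i\<bar> / real N)"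
      using N0 by (simp add: diff_divide_distrib)
    finally show ?thesis .
  qed
  then have ev: "\<forall>\<^sub>F N in sequentially. ?r N = real (card (cube_boundary u N)) / real N ^ CARD('n)"
    by (auto simp: eventually_at_top_linorder intro!: exI[of _ K])
  have "?r \<longlonglongrightarrow> 2 * (1 - (\<Prod>i\<in>(UNIV::'n set). (1 - 0)))"
    by (intro tendsto_intros lim_const_over_n)
  then have "?r \<longlonglongrightarrow> 0" by simp
  then show ?thesis using ev by (rule Lim_transform_eventually)
qed

section \<open>Functions with vanishing mean over growing cubes\<close>

definition mean_zero :: "(int ^ 'n \<Rightarrow> real) \<Rightarrow> bool" where
  "mean_zero h \<longleftrightarrow> (\<lambda>N. (\<Sum>x\<in>cube N. h x) / real N ^ CARD('n)) \<longlonglongrightarrow> 0"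

lemma mean_zero_0 [simp]: "mean_zero (\<lambda>x. 0)"
  by (simp add: mean_zero_def)

lemma mean_zero_add: "mean_zero g \<Longrightarrow> mean_zero h \<Longrightarrow> mean_zero (\<lambda>x. g x + h x)"
  unfolding mean_zero_def by (drule (1) tendsto_add) (simp add: sum.distrib add_divide_distrib)

lemma mean_zero_cmult: "mean_zero h \<Longrightarrow> mean_zero (\<lambda>x. c * h x)"
  unfolding mean_zero_def by (drule tendsto_mult_left[of _ _ _ c]) (simp add: sum_distrib_left)

lemma mean_zero_sum: "(\<And>i. i \<in> A \<Longrightarrow> mean_zero (h i)) \<Longrightarrow> mean_zero (\<lambda>x. \<Sum>i\<in>A. h i x)"
  by (induction A rule: infinite_finite_induct) (auto intro: mean_zero_add)

lemma mean_zero_mono: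
  assumes "mean_zero h" "\<And>x. 0 \<le> g x" "\<And>x. g x \<le> h x"
  shows "mean_zero g"
  unfolding mean_zero_def
proof (rule tendsto_sandwich[OF _ _ tendsto_const])
  show "(\<lambda>N. (\<Sum>x\<in>cube N. h x) / real N ^ CARD('a)) \<longlonglongrightarrow> 0"
    using assms(1) by (simp add: mean_zero_def)
qed (use assms(2,3) in \<open>auto intro!: always_eventually divide_right_mono sum_mono divide_nonneg_nonneg sum_nonneg\<close>)

text \<open>The sums over the cube and its translate cancel on the overlap. What remains lives on
  the boundary, where h is bounded by 1.\<close>

lemma mean_zero_shift:
  fixes h :: "int ^ 'n \<Rightarrow> real"
  assumes "\<And>x. \<bar>h x\<bar> \<le> 1"
  shows "mean_zero (\<lambda>x. h (x - u) - h x)"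
  unfolding mean_zero_def
\<comment> \<open>Summing h (x - u) over the cube is summing h over the cube moved by - u, whence
  the sign.\<close>
proof (rule Lim_null_comparison[OF always_eventually cube_boundary_density[of "- u"]], rule allI)
  fix N
  let ?A = "(+) (- u) ` cube N" and ?B = "cube N :: (int ^ 'n) set"
  have "(\<Sum>x\<in>cube N. h (x - u)) = sum h ?A"
    by (subst sum.reindex) (auto simp: inj_on_def)
  moreover have "sum h ?A = sum h (?A - ?B) + sum h (?A \<inter> ?B)"
    by (subst add.commute, rule sum.Int_Diff) simp
  moreover have "sum h ?B = sum h (?B - ?A) + sum h (?A \<inter> ?B)"
    by (subst add.commute, subst Int_commute, rule sum.Int_Diff) simp
  ultimately have "(\<Sum>x\<in>cube N. h (x - u) - h x) = sum h (?A - ?B) - sum h (?B - ?A)"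
    by (simp add: sum_subtractf)
  also have "\<bar>\<dots>\<bar> \<le> (\<Sum>x\<in>?A - ?B. \<bar>h x\<bar>) + (\<Sum>x\<in>?B - ?A. \<bar>h x\<bar>)"
    using sum_abs[of h "?A - ?B"] sum_abs[of h "?B - ?A"] by linarith
  also have "\<dots> = (\<Sum>x\<in>cube_boundary (- u) N. \<bar>h x\<bar>)"
    unfolding cube_boundary_def by (rule sum.union_disjoint[symmetric]) auto
  also have "\<dots> \<le> real (card (cube_boundary (- u) N))"
    using sum_bounded_above[of "cube_boundary (- u) N" "\<lambda>x. \<bar>h x\<bar>" 1] assms by simp
  finally show "norm ((\<Sum>x\<in>cube N. h (x - u) - h x) / real N ^ CARD('n))
      \<le> real (card (cube_boundary (- u) N)) / real N ^ CARD('n)"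
    by (simp add: divide_right_mono)
qed

abbreviation zero_density :: "(int ^ 'n) set \<Rightarrow> bool" where
  "zero_density E \<equiv> mean_zero (indicator E)"

section \<open>Dilations cover almost every point once\<close>

lemma zero_density_subset: "zero_density F \<Longrightarrow> E \<subseteq> F \<Longrightarrow> zero_density E"
  by (rule mean_zero_mono[of "indicator F"]) (auto simp: indicator_def)

lemma zero_density_shift:
  assumes "zero_density E"
  shows "zero_density {x. x - u \<in> E}"
proof -
  have "mean_zero (\<lambda>x. (indicator E (x - u) - indicator E x) + indicator E x)"
    by (intro mean_zero_add mean_zero_shift assms) (auto simp: indicator_def)
  moreover have "indicator E (x - u) = (indicator {x. x - u \<in> E} x :: real)" for x
    by (simp add: indicator_def)
  ultimately show ?thesis by simp
qed

lemma zero_density_UN: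
  assumes "finite A" "\<And>i. i \<in> A \<Longrightarrow> zero_density (E i)"
  shows "zero_density (\<Union>i\<in>A. E i)"
proof (rule mean_zero_mono)
  show "mean_zero (\<lambda>x. \<Sum>i\<in>A. indicator (E i) x)"
    using assms(2) by (intro mean_zero_sum)
  show "indicator (\<Union>i\<in>A. E i) x \<le> (\<Sum>i\<in>A. indicator (E i) x :: real)" for x
  proof (cases "x \<in> (\<Union>i\<in>A. E i)")
    case True
    then obtain i where i: "i \<in> A" "x \<in> E i" by blast
    then have "(1::real) = indicator (E i) x" by simp
    also have "\<dots> \<le> (\<Sum>i\<in>A. indicator (E i) x)"
      using i assms(1) by (intro member_le_sum) auto
    finally show ?thesis using True by simp
  qed (simp add: sum_nonneg)
qed auto

text \<open>Each further factor V sums card V translates of the previous function, so the new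
  exceptional set lies in a finite union of translates of the old one. Starting at exponent
  \<open>Suc 0\<close> makes the base case the hypothesis.\<close>

lemma zero_density_convolve_power:
  assumes "finite V" "zero_density {x. hits V f a x \<noteq> 1}"
  shows "zero_density {x. convolve ((\<Sum>v\<in>V. frag_of (a *s v)) ^ Suc m) f x \<noteq> int (card V) ^ m}"
proof (induction m)
  case 0
  show ?case using assms(2) by (simp add: convolve_sum hits_def)
next
  case (Suc m)
  let ?P = "\<Sum>v\<in>V. frag_of (a *s v)"
  let ?E = "{x. convolve (?P ^ Suc m) f x \<noteq> int (card V) ^ m}"
  have "zero_density (\<Union>v\<in>V. {x. x - a *s v \<in> ?E})"
    by (intro zero_density_UN zero_density_shift Suc assms(1))
  moreover have "convolve (?P ^ Suc (Suc m)) f x = int (card V) ^ Suc m"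
    if "x \<notin> (\<Union>v\<in>V. {x. x - a *s v \<in> ?E})" for x
  proof -
    have "\<forall>v\<in>V. convolve (?P ^ Suc m) f (x - a *s v) = int (card V) ^ m" using that by blast
    then have "convolve (?P ^ Suc (Suc m)) f x = (\<Sum>v\<in>V. int (card V) ^ m)"
      by (subst convolve_power_Suc) (rule sum.cong, auto)
    then show ?thesis by simp
  qed
  ultimately show ?case by (elim zero_density_subset) blast
qed

text \<open>Both counts compare with card V copies of f. The mean of f itself may fail to exist, so
  only a difference is claimed.\<close>

lemma mean_zero_hits_diff:
  assumes "\<And>x. \<bar>f x\<bar> \<le> 1"
  shows "mean_zero (\<lambda>x. real_of_int (hits V f a x) - real_of_int (hits V f b x))"
proof -
  have *: "mean_zero (\<lambda>x. \<Sum>v\<in>V. real_of_int (f (x - c *s v)) - real_of_int (f x))" for c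
    using assms by (intro mean_zero_sum mean_zero_shift) (simp flip: of_int_abs)
  have "mean_zero (\<lambda>x. (\<Sum>v\<in>V. real_of_int (f (x - a *s v)) - real_of_int (f x))
      + (-1) * (\<Sum>v\<in>V. real_of_int (f (x - b *s v)) - real_of_int (f x)))"
    by (intro mean_zero_add mean_zero_cmult *)
  then show ?thesis by (simp add: hits_def sum_subtractf)
qed

text \<open>Off a null set the new count is 1 modulo p, hence at least 1. As it has the same mean as
  the constant count 1, it can exceed 1 only on a null set.\<close>

lemma zero_density_hits_prime_mult:
  assumes V: "finite V" and p: "prime p" "\<not> p dvd card V"
    and f: "\<And>x. f x \<in> {0, 1}" and one: "\<And>x. hits V f 1 x = 1"
    and null: "zero_density {x. hits V f a x \<noteq> 1}"
  shows "zero_density {x. hits V f (int p * a) x \<noteq> 1}"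
proof -
  define c where "c = hits V f (int p * a)"
  define E where "E = {x. convolve ((\<Sum>v\<in>V. frag_of (a *s v)) ^ Suc (p - 1)) f x \<noteq> int (card V) ^ (p - 1)}"
  have E: "zero_density E" unfolding E_def by (rule zero_density_convolve_power[OF V null])
  have Suc: "Suc (p - 1) = p" using prime_gt_0_nat[OF p(1)] by simp
  have c0: "c x \<ge> 0" for x
    unfolding c_def hits_def using f by (intro sum_nonneg) (metis empty_iff insert_iff order_refl zero_le_one)
  have c1: "c x \<ge> 1" if "x \<notin> E" for x
  proof -
    have "[c x = int (card V) ^ (p - 1)] (mod int p)"
      using hits_prime_cong[OF V p(1), of f a x] that unfolding c_def E_def Suc by simp
    also have "[int (card V) ^ (p - 1) = 1] (mod int p)"
      using fermat_theorem[OF p] by (metis cong_int_iff of_nat_1 of_nat_power)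
    \<comment> \<open>The value 0 is not congruent to 1 modulo a prime.\<close>
    finally have "c x \<noteq> 0"
      using prime_gt_1_nat[OF p(1)] by (auto simp: cong_def)
    with c0[of x] show ?thesis by linarith
  qed
  have f1: "\<bar>f x\<bar> \<le> 1" for x using f[of x] by auto
  \<comment> \<open>On E the difference c - 1 may drop to -1; adding 2 there makes the function
    dominate the indicator of the bad set.\<close>
  have "mean_zero (\<lambda>x. (real_of_int (c x) - real_of_int (hits V f 1 x)) + 2 * indicator E x)"
    unfolding c_def by (intro mean_zero_add mean_zero_cmult E mean_zero_hits_diff f1)
  then have "mean_zero (\<lambda>x. real_of_int (c x) - 1 + 2 * indicator E x)" by (simp add: one)
  then show ?thesis
  proof (rule mean_zero_mono)
    fix x
    show "indicator {x. hits V f (int p * a) x \<noteq> 1} x \<le> real_of_int (c x) - 1 + 2 * indicator E x"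
    proof (cases "x \<in> E")
      case True
      then show ?thesis using c0[of x] by (auto simp: indicator_def)
    next
      case False
      then show ?thesis using c1[of x] by (auto simp: indicator_def c_def)
    qed
  qed auto
qed

text \<open>Starting from the exact tiling at a = 1, the prime factors of a are multiplied in one by
  one; coprimality keeps each from dividing card V.\<close>

lemma zero_density_hits_coprime:
  assumes V: "finite V" and f: "\<And>x. f x \<in> {0, 1}" and one: "\<And>x. hits V f 1 x = 1"
    and a: "a > 0" "coprime a (card V)"
  shows "zero_density {x. hits V f (int a) x \<noteq> 1}"
  using a
proof (induction a rule: prime_divisors_induct)
  case zero
  then show ?case by simp
next
  case (unit a)
  then show ?case by (simp add: one)
next
  case (factor p a)
  then have "\<not> p dvd card V"
    by (metis coprime_common_divisor dvd_triv_left not_prime_unit)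
  with factor show ?case
    using zero_density_hits_prime_mult[OF V \<open>prime p\<close> _ f one, of "int a"] by simp
qed

section \<open>Parseval's identity over roots of unity\<close>

text \<open>On the unit torus, k maps to a character of the lattice.\<close>

definition monomial_at :: "complex ^ 'n \<Rightarrow> int ^ 'n \<Rightarrow> complex" where
  "monomial_at x k = (\<Prod>i\<in>UNIV. (x $ i) powi (k $ i))"

definition unit_torus :: "(complex ^ 'n) set" where
  "unit_torus = {x. \<forall>i. norm (x $ i) = 1}"

lemma unit_torus_nonzero: "x \<in> unit_torus \<Longrightarrow> x $ i \<noteq> 0"
  unfolding unit_torus_def by (metis (mono_tags) mem_Collect_eq norm_zero zero_neq_one)

lemma monomial_at_add:
  "x \<in> unit_torus \<Longrightarrow> monomial_at x (k + l) = monomial_at x k * monomial_at x l"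
  by (simp add: monomial_at_def power_int_add unit_torus_nonzero prod.distrib)

lemma monomial_at_0 [simp]: "monomial_at x 0 = 1"
  by (simp add: monomial_at_def)

lemma monomial_at_uminus:
  assumes "x \<in> unit_torus"
  shows "monomial_at x (- k) = cnj (monomial_at x k)"
proof -
  have "(x $ i) powi (- (k $ i)) = cnj ((x $ i) powi (k $ i))" for i
  proof -
    have "norm ((x $ i) powi (k $ i)) = 1"
      using assms by (simp add: norm_power_int unit_torus_def)
    then have "inverse ((x $ i) powi (k $ i)) = cnj ((x $ i) powi (k $ i))"
      by (intro inverse_unique) (simp only: complex_norm_square[symmetric], simp)
    then show ?thesis by (simp add: power_int_minus)
  qed
  then show ?thesis by (simp add: monomial_at_def)
qed

lemma monomial_at_powi: "monomial_at (\<chi> i. (x $ i) powi a) k = monomial_at x (a *s k)"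
  by (simp add: monomial_at_def power_int_mult)

text \<open>By counting: there are M roots of unity of order dividing M, but only |d| < M solutions
  of z^|d| = 1.\<close>

lemma root_of_unity_powi_neq_1:
  assumes "d \<noteq> 0" "\<bar>d\<bar> < int M"
  obtains w :: complex where "w ^ M = 1" "w powi d \<noteq> 1"
proof -
  let ?m = "nat \<bar>d\<bar>"
  have "card {z::complex. z ^ ?m = 1} < card {z::complex. z ^ M = 1}"
    using assms by (subst (1 2) card_roots_unity_eq) auto
  moreover have "finite {z::complex. z ^ ?m = 1}"
    using assms by (intro finite_roots_unity) auto
  ultimately have "\<not> {z::complex. z ^ M = 1} \<subseteq> {z. z ^ ?m = 1}"
    using card_mono[of "{z::complex. z ^ ?m = 1}" "{z. z ^ M = 1}"] by linarith
  then obtain w :: complex where w: "w ^ M = 1" "w ^ ?m \<noteq> 1" by blast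
  have "w powi d \<noteq> 1"
  proof (cases "d \<ge> 0")
    case True
    with w(2) show ?thesis by (simp add: power_int_def)
  next
    case False
    with w(2) show ?thesis by (simp add: power_int_def power_inverse)
  qed
  with w(1) that show ?thesis by blast
qed

text \<open>Multiplying one coordinate by a root of unity permutes the summation set but scales
  the sum by a factor different from 1.\<close>

lemma sum_monomial_at_roots_of_unity:
  fixes d :: "int ^ 'n"
  assumes "d $ j \<noteq> 0" "\<bar>d $ j\<bar> < int M"
  shows "(\<Sum>x\<in>{x. \<forall>i. x $ i \<in> {z. z ^ M = 1}}. monomial_at x d) = 0"
proof -
  let ?X = "{x :: complex ^ 'n. \<forall>i. x $ i \<in> {z. z ^ M = 1}}"
  obtain w :: complex where w: "w ^ M = 1" "w powi (d $ j) \<noteq> 1"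
    using root_of_unity_powi_neq_1[OF assms] .
  have w0: "w \<noteq> 0" using w(1) assms(2) by (auto simp: power_0_left split: if_splits)
  define r :: "complex \<Rightarrow> complex ^ 'n \<Rightarrow> complex ^ 'n"
    where "r u x = (\<chi> i. (if i = j then u else 1) * x $ i)" for u x
  have "(\<Sum>x\<in>?X. monomial_at x d) = (\<Sum>x\<in>?X. monomial_at (r w x) d)"
  proof (rule sum.reindex_bij_witness[where i = "r w" and j = "r (inverse w)"])
    have r: "r u (r v x) = x" if "u * v = 1" for u v x
      using that by (simp add: r_def vec_eq_iff mult.assoc[symmetric])
    fix x assume "x \<in> ?X"
    then show "r w x \<in> ?X" "r (inverse w) x \<in> ?X"
      using w(1) by (auto simp: r_def power_mult_distrib power_inverse)
    show "r w (r (inverse w) x) = x" "r (inverse w) (r w x) = x"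
      using w0 by (simp_all add: r)
    then show "monomial_at (r w (r (inverse w) x)) d = monomial_at x d" by simp
  qed
  also have "\<dots> = (\<Sum>x\<in>?X. w powi (d $ j) * monomial_at x d)"
  proof (rule sum.cong[OF refl])
    fix x
    have "monomial_at (r w x) d
        = (\<Prod>i\<in>UNIV. (if i = j then w powi (d $ i) else 1)) * monomial_at x d"
      unfolding monomial_at_def prod.distrib[symmetric]
      by (rule prod.cong) (auto simp: r_def power_int_mult_distrib)
    then show "monomial_at (r w x) d = w powi (d $ j) * monomial_at x d" by simp
  qed
  also have "\<dots> = w powi (d $ j) * (\<Sum>x\<in>?X. monomial_at x d)"
    by (rule sum_distrib_left[symmetric])
  finally have "(\<Sum>x\<in>?X. monomial_at x d) = w powi (d $ j) * (\<Sum>x\<in>?X. monomial_at x d)" .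
  then show ?thesis
    using w(2) mult_cancel_right[of 1 "\<Sum>x\<in>?X. monomial_at x d" "w powi (d $ j)"] by force
qed

text \<open>Over roots of unity of large enough order M, the characters with exponents in S are
  orthogonal. The set X depends on S alone, so it serves all coefficient families at once.\<close>

lemma discrete_parseval:
  fixes S :: "(int ^ 'n) set"
  assumes "finite S"
  obtains X :: "(complex ^ 'n) set" where "finite X" "X \<noteq> {}" "X \<subseteq> unit_torus"
    "\<And>c. (\<Sum>x\<in>X. (norm (\<Sum>k\<in>S. c k * monomial_at x k))\<^sup>2) = real (card X) * (\<Sum>k\<in>S. (norm (c k))\<^sup>2)"
proof -
  \<comment> \<open>M exceeds twice every coordinate occurring in S, hence every coordinate of a
    difference k - l.\<close>
  define M where "M = Suc (nat (2 * (\<Sum>k\<in>S. \<Sum>i\<in>UNIV. \<bar>k $ i\<bar>)))"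
  define X where "X = {x :: complex ^ 'n. \<forall>i. x $ i \<in> {z. z ^ M = 1}}"
  have X: "finite X" unfolding X_def
    by (intro finite_vec_box finite_roots_unity) (simp add: M_def)
  have "(\<chi> i. 1) \<in> X" by (simp add: X_def)
  then have ne: "X \<noteq> {}" by blast
  have "norm z = 1" if "z ^ M = 1" for z :: complex
  proof -
    have "norm z ^ M = 1 ^ M" using that by (simp flip: norm_power)
    then show ?thesis by (rule power_eq_imp_eq_base) (simp_all add: M_def)
  qed
  then have sub: "X \<subseteq> unit_torus" by (auto simp: X_def unit_torus_def)
  have bound: "2 * \<bar>k $ j\<bar> < int M" if "k \<in> S" for k j
  proof -
    have "\<bar>k $ j\<bar> \<le> (\<Sum>i\<in>UNIV. \<bar>k $ i\<bar>)"
      using member_le_sum[of j UNIV "\<lambda>i. \<bar>k $ i\<bar>"] by simp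
    also have "\<dots> \<le> (\<Sum>k\<in>S. \<Sum>i\<in>UNIV. \<bar>k $ i\<bar>)"
      using that assms by (intro member_le_sum) (auto intro: sum_nonneg)
    finally show ?thesis by (simp add: M_def)
  qed
  have orth: "(\<Sum>x\<in>X. monomial_at x (k - l)) = (if k = l then of_nat (card X) else 0)"
    if "k \<in> S" "l \<in> S" for k l
  proof (cases "k = l")
    case False
    then obtain j where "k $ j \<noteq> l $ j" by (auto simp: vec_eq_iff)
    moreover have "\<bar>k $ j - l $ j\<bar> < int M"
      using bound[OF that(1), of j] bound[OF that(2), of j] by linarith
    ultimately show ?thesis
      using sum_monomial_at_roots_of_unity[of "k - l" j M] False by (simp add: X_def)
  qed simp
  have "(\<Sum>x\<in>X. (norm (\<Sum>k\<in>S. c k * monomial_at x k))\<^sup>2) = real (card X) * (\<Sum>k\<in>S. (norm (c k))\<^sup>2)"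
    for c
  proof -
    have "complex_of_real ((norm (\<Sum>k\<in>S. c k * monomial_at x k))\<^sup>2)
        = (\<Sum>k\<in>S. \<Sum>l\<in>S. c k * cnj (c l) * monomial_at x (k - l))" if "x \<in> X" for x
    proof -
      have x: "x \<in> unit_torus" using that sub by blast
      have diff: "monomial_at x (k - l) = monomial_at x k * cnj (monomial_at x l)" for k l
        using monomial_at_add[OF x, of k "- l"] by (simp add: monomial_at_uminus[OF x])
      have "complex_of_real ((norm (\<Sum>k\<in>S. c k * monomial_at x k))\<^sup>2)
          = (\<Sum>k\<in>S. c k * monomial_at x k) * (\<Sum>l\<in>S. cnj (c l) * cnj (monomial_at x l))"
        by (simp only: complex_norm_square) simp
      also have "\<dots> = (\<Sum>k\<in>S. \<Sum>l\<in>S. c k * cnj (c l) * monomial_at x (k - l))"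
        by (simp add: sum_product diff mult_ac)
      finally show ?thesis .
    qed
    then have "complex_of_real (\<Sum>x\<in>X. (norm (\<Sum>k\<in>S. c k * monomial_at x k))\<^sup>2)
        = (\<Sum>x\<in>X. \<Sum>k\<in>S. \<Sum>l\<in>S. c k * cnj (c l) * monomial_at x (k - l))"
      unfolding of_real_sum by (rule sum.cong[OF refl])
    also have "\<dots> = (\<Sum>k\<in>S. \<Sum>l\<in>S. \<Sum>x\<in>X. c k * cnj (c l) * monomial_at x (k - l))"
      by (subst sum.swap, rule sum.cong[OF refl], rule sum.swap)
    also have "\<dots> = (\<Sum>k\<in>S. \<Sum>l\<in>S. if k = l then c k * cnj (c l) * of_nat (card X) else 0)"
      by (intro sum.cong refl) (auto simp: orth simp flip: sum_distrib_left)
    also have "\<dots> = (\<Sum>k\<in>S. c k * cnj (c k) * of_nat (card X))"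
      using assms by simp
    also have "\<dots> = complex_of_real (real (card X) * (\<Sum>k\<in>S. (norm (c k))\<^sup>2))"
      by (simp add: sum_distrib_left sum_distrib_right complex_norm_square mult_ac del: of_real_power)
    finally show ?thesis using of_real_eq_iff by blast
  qed
  with X ne sub show ?thesis by (rule that)
qed

section \<open>Common zeros on the unit torus\<close>

text \<open>Finite support makes the Fourier sums finite.\<close>

definition trunc :: "nat \<Rightarrow> (int ^ 'n \<Rightarrow> real) \<Rightarrow> int ^ 'n \<Rightarrow> real" where
  "trunc N g y = indicator (cube N) y * g y"

text \<open>Convolution becomes multiplication. The set S must contain the cube and its translates,
  so that no mass is lost.\<close>

lemma fourier_trunc_shift_sum:
  fixes x :: "complex ^ 'n"
  assumes x: "x \<in> unit_torus" and "finite S" "\<And>v. v \<in> V \<Longrightarrow> (+) (a *s v) ` cube N \<subseteq> S" "cube N \<subseteq> S"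
  shows "(\<Sum>y\<in>S. of_real (\<Sum>v\<in>V. trunc N g (y - a *s v)) * monomial_at x y)
    = (\<Sum>v\<in>V. monomial_at x (a *s v)) * (\<Sum>y\<in>S. of_real (trunc N g y) * monomial_at x y)"
proof -
  let ?t = "\<lambda>y. complex_of_real (trunc N g y)"
  have zero: "trunc N g y = 0" if "y \<notin> cube N" for y
    using that by (simp add: trunc_def)
  have shift: "(\<Sum>y\<in>S. ?t (y - u) * monomial_at x y) = monomial_at x u * (\<Sum>y\<in>cube N. ?t y * monomial_at x y)"
    if "(+) u ` cube N \<subseteq> S" for u
  proof -
    have "(\<Sum>y\<in>S. ?t (y - u) * monomial_at x y) = (\<Sum>y\<in>(+) u ` cube N. ?t (y - u) * monomial_at x y)"
      using that assms(2) by (intro sum.mono_neutral_right) (auto simp: zero mem_plus_image_iff)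
    also have "\<dots> = (\<Sum>y\<in>cube N. ?t y * monomial_at x (u + y))"
      by (subst sum.reindex) auto
    finally show ?thesis by (simp add: monomial_at_add[OF x] sum_distrib_left mult_ac)
  qed
  have "(\<Sum>y\<in>S. of_real (\<Sum>v\<in>V. trunc N g (y - a *s v)) * monomial_at x y)
      = (\<Sum>v\<in>V. \<Sum>y\<in>S. ?t (y - a *s v) * monomial_at x y)"
    by (subst sum.swap) (simp add: sum_distrib_right)
  also have "\<dots> = (\<Sum>v\<in>V. monomial_at x (a *s v)) * (\<Sum>y\<in>cube N. ?t y * monomial_at x y)"
    unfolding sum_distrib_right using assms(3) by (intro sum.cong refl shift)
  also have "(\<Sum>y\<in>cube N. ?t y * monomial_at x y) = (\<Sum>y\<in>S. ?t y * monomial_at x y)"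
    using assms(2,4) by (intro sum.mono_neutral_left) (auto simp: zero)
  finally show ?thesis .
qed

text \<open>Truncation and convolution commute up to boundary errors. Since the truncated
  convolution is bounded by card V, its square is at most card V times its absolute value, which
  leaves a first-moment estimate.\<close>

lemma sum_trunc_shift_sum_square_le:
  fixes g :: "int ^ 'n \<Rightarrow> real"
  assumes "finite S" and g: "\<And>y. \<bar>g y\<bar> \<le> 1"
  shows "(\<Sum>y\<in>S. (\<Sum>v\<in>V. trunc N g (y - a *s v))\<^sup>2)
    \<le> real (card V) * ((\<Sum>v\<in>V. real (card (cube_boundary (a *s v) N)))
        + (\<Sum>y\<in>cube N. \<bar>\<Sum>v\<in>V. g (y - a *s v)\<bar>))"
proof -
  let ?H = "\<lambda>y. \<Sum>v\<in>V. trunc N g (y - a *s v)"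
  let ?I = "\<lambda>B y. indicator B y :: real"
  define b where "b y = (\<Sum>v\<in>V. ?I (cube_boundary (a *s v) N) y)" for y
  define e where "e y = ?I (cube N) y * \<bar>\<Sum>v\<in>V. g (y - a *s v)\<bar>" for y
  have ind: "\<bar>?I (cube N) (y - u) - ?I (cube N) y\<bar> \<le> ?I (cube_boundary u N) y" for y u :: "int ^ 'n"
  proof -
    have "y \<in> (+) u ` cube N \<longleftrightarrow> y - u \<in> cube N" by (rule mem_plus_image_iff)
    then show ?thesis by (auto simp: cube_boundary_def indicator_def)
  qed
  have Hle: "\<bar>?H y\<bar> \<le> b y + e y" for y
  proof -
    \<comment> \<open>Cutting off at y instead of at y - a v isolates the boundary error.\<close>
    have "?H y = (\<Sum>v\<in>V. (?I (cube N) (y - a *s v) - ?I (cube N) y) * g (y - a *s v))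
        + ?I (cube N) y * (\<Sum>v\<in>V. g (y - a *s v))"
      by (simp add: trunc_def sum_distrib_left algebra_simps sum_subtractf)
    also have "\<bar>\<dots>\<bar> \<le> (\<Sum>v\<in>V. \<bar>(?I (cube N) (y - a *s v) - ?I (cube N) y) * g (y - a *s v)\<bar>) + e y"
      unfolding e_def by (intro order_trans[OF abs_triangle_ineq] add_mono sum_abs) (simp add: abs_mult)
    also have "\<dots> \<le> b y + e y"
      unfolding b_def
    proof (intro add_right_mono sum_mono)
      fix v
      show "\<bar>(?I (cube N) (y - a *s v) - ?I (cube N) y) * g (y - a *s v)\<bar> \<le> ?I (cube_boundary (a *s v) N) y"
        using mult_mono[OF ind[of y "a *s v"] g[of "y - a *s v"]] by (simp add: abs_mult)
    qed
    finally show ?thesis .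
  qed
  have Hk: "\<bar>?H y\<bar> \<le> real (card V)" for y
  proof -
    have "\<bar>?H y\<bar> \<le> (\<Sum>v\<in>V. \<bar>trunc N g (y - a *s v)\<bar>)" by (rule sum_abs)
    also have "\<dots> \<le> real (card V) * 1"
      using g by (intro sum_bounded_above) (auto simp: trunc_def abs_mult indicator_def)
    finally show ?thesis by simp
  qed
  have be: "0 \<le> b y + e y" for y
    by (simp add: b_def e_def sum_nonneg)
  have "(?H y)\<^sup>2 \<le> real (card V) * (b y + e y)" for y
    using mult_mono[OF Hk[of y] Hle[of y]] by (simp add: power2_eq_square)
  then have "(\<Sum>y\<in>S. (?H y)\<^sup>2) \<le> real (card V) * (\<Sum>y\<in>S. b y + e y)"
    by (simp add: sum_distrib_left sum_mono)
  also have "\<dots> = real (card V) * ((\<Sum>v\<in>V. \<Sum>y\<in>S. ?I (cube_boundary (a *s v) N) y) + (\<Sum>y\<in>S. e y))"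
    unfolding sum.distrib b_def by (subst sum.swap) simp
  also have "\<dots> \<le> real (card V) * ((\<Sum>v\<in>V. real (card (cube_boundary (a *s v) N)))
        + (\<Sum>y\<in>cube N. \<bar>\<Sum>v\<in>V. g (y - a *s v)\<bar>))"
  proof (intro mult_left_mono add_mono sum_mono)
    fix v
    have "(\<Sum>y\<in>S. ?I (cube_boundary (a *s v) N) y) = real (card (S \<inter> cube_boundary (a *s v) N))"
      using assms(1) by (simp add: indicator_def sum_of_bool_eq)
    also have "\<dots> \<le> real (card (cube_boundary (a *s v) N))"
      by (simp add: card_mono)
    finally show "(\<Sum>y\<in>S. ?I (cube_boundary (a *s v) N) y) \<le> real (card (cube_boundary (a *s v) N))" .
  next
    have "(\<Sum>y\<in>S. e y) = (\<Sum>y\<in>S \<inter> cube N. e y)"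
      using assms(1) by (intro sum.mono_neutral_right) (auto simp: e_def)
    also have "\<dots> \<le> (\<Sum>y\<in>cube N. e y)"
      by (intro sum_mono2) (auto simp: e_def)
    also have "\<dots> = (\<Sum>y\<in>cube N. \<bar>\<Sum>v\<in>V. g (y - a *s v)\<bar>)"
      by (simp add: e_def)
    finally show "(\<Sum>y\<in>S. e y) \<le> (\<Sum>y\<in>cube N. \<bar>\<Sum>v\<in>V. g (y - a *s v)\<bar>)" .
  qed simp
  finally show ?thesis .
qed

text \<open>Otherwise at each point of X some |q_a|^2 exceeds \<epsilon>. Weighting by |G|^2 and
  summing, the Parseval lower bound for G contradicts the fact that all products q_a G together have
  energy of smaller order than the cube.\<close>

lemma ex_unit_torus_almost_zero:
  fixes V :: "(int ^ 'n) set"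
  assumes V: "finite V" and k: "card V \<ge> 2"
    and f: "\<And>x. f x \<in> {0, 1}" and one: "\<And>x. hits V f 1 x = 1" and eps: "\<epsilon> > 0"
  shows "\<exists>x\<in>unit_torus. \<forall>a\<in>{0<..T}. coprime a (card V) \<longrightarrow>
    (norm (\<Sum>v\<in>V. monomial_at x (int a *s v)))\<^sup>2 \<le> \<epsilon>"
proof -
  define k where "k = real (card V)"
  have f01: "0 \<le> f y" "f y \<le> 1" for y using f[of y] by auto
  have k2: "k \<ge> 2" using assms(2) by (simp add: k_def)
  define A where "A = {a \<in> {0<..T}. coprime a (card V)}"
  have finA: "finite A" by (simp add: A_def)
  \<comment> \<open>Subtracting 1/k turns the count into count minus 1, which vanishes almost
    everywhere, while g stays away from 0.\<close>
  define g where "g y = real_of_int (f y) - 1 / k" for y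
  define q where "q a x = (\<Sum>v\<in>V. monomial_at x (int a *s v))" for a and x :: "complex ^ 'n"
  have g1: "\<bar>g y\<bar> \<le> 1" and g2: "(g y)\<^sup>2 \<ge> 1 / k\<^sup>2" for y
  proof -
    \<comment> \<open>Here k at least 2 enters: it makes the value 1 - 1/k at least 1/k.\<close>
    have "1 / k \<le> 1 / 2" "1 / k > 0" using k2 by (auto simp: field_simps)
    then have "\<bar>g y\<bar> \<le> 1 \<and> \<bar>g y\<bar> \<ge> 1 / k" using f[of y] by (auto simp: g_def)
    moreover from this have "(1 / k)\<^sup>2 \<le> \<bar>g y\<bar>\<^sup>2" using k2 by (intro power_mono) auto
    ultimately show "\<bar>g y\<bar> \<le> 1" "(g y)\<^sup>2 \<ge> 1 / k\<^sup>2" by (auto simp: power_divide)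
  qed
  have sum_g: "(\<Sum>v\<in>V. g (y - a *s v)) = real_of_int (hits V f a y) - 1" for a y
    using k2 by (simp add: g_def hits_def sum_subtractf flip: k_def)
  define D where "D a N = k * ((\<Sum>v\<in>V. real (card (cube_boundary (int a *s v) N)))
        + (\<Sum>y\<in>cube N. \<bar>\<Sum>v\<in>V. g (y - int a *s v)\<bar>))" for a N
  have "(\<lambda>N. D a N / real N ^ CARD('n)) \<longlonglongrightarrow> 0" if "a \<in> A" for a
  proof -
    have "mean_zero (\<lambda>y. (k + 1) * indicator {x. hits V f (int a) x \<noteq> 1} y)"
      using that zero_density_hits_coprime[OF V f one, of a] by (intro mean_zero_cmult) (auto simp: A_def)
    then have "mean_zero (\<lambda>y. \<bar>\<Sum>v\<in>V. g (y - int a *s v)\<bar>)"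
    proof (rule mean_zero_mono)
      fix y
      have "0 \<le> hits V f (int a) y" "hits V f (int a) y \<le> int (card V) * 1"
        unfolding hits_def using f01 by (auto intro!: sum_nonneg sum_bounded_above[of V _ 1, simplified])
      then show "\<bar>\<Sum>v\<in>V. g (y - int a *s v)\<bar> \<le> (k + 1) * indicator {x. hits V f (int a) x \<noteq> 1} y"
        by (auto simp: sum_g indicator_def k_def)
    qed simp
    then have "(\<lambda>N. k * ((\<Sum>v\<in>V. real (card (cube_boundary (int a *s v) N)) / real N ^ CARD('n))
        + (\<Sum>y\<in>cube N. \<bar>\<Sum>v\<in>V. g (y - int a *s v)\<bar>) / real N ^ CARD('n))) \<longlonglongrightarrow> k * ((\<Sum>v\<in>V. 0) + 0)"
      unfolding mean_zero_def by (intro tendsto_intros cube_boundary_density)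
    moreover have "D a N / real N ^ CARD('n) = k * ((\<Sum>v\<in>V. real (card (cube_boundary (int a *s v) N)) / real N ^ CARD('n))
        + (\<Sum>y\<in>cube N. \<bar>\<Sum>v\<in>V. g (y - int a *s v)\<bar>) / real N ^ CARD('n))" for N
      by (simp add: D_def add_divide_distrib flip: sum_divide_distrib times_divide_eq_right)
    ultimately show ?thesis by simp
  qed
  then have "(\<lambda>N. \<Sum>a\<in>A. D a N / real N ^ CARD('n)) \<longlonglongrightarrow> (\<Sum>a\<in>A. 0)"
    by (intro tendsto_sum)
  \<comment> \<open>The threshold matches the lower bound N^n / k^2 for the energy of the truncated
    g.\<close>
  then have "\<forall>\<^sub>F N in sequentially. (\<Sum>a\<in>A. D a N / real N ^ CARD('n)) < \<epsilon> / k\<^sup>2"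
    using eps k2 by (intro order_tendstoD(2)) auto
  then obtain M where M: "\<And>N. N \<ge> M \<Longrightarrow> (\<Sum>a\<in>A. D a N / real N ^ CARD('n)) < \<epsilon> / k\<^sup>2"
    unfolding eventually_sequentially by blast
  define N where "N = Suc M"
  have N: "(\<Sum>a\<in>A. D a N / real N ^ CARD('n)) < \<epsilon> / k\<^sup>2" "N > 0"
    by (rule M) (simp_all add: N_def)
  \<comment> \<open>One set carries the supports for all a in A, so a single X works for all of
    them.\<close>
  define S where "S = cube N \<union> (\<Union>a\<in>A. \<Union>v\<in>V. (+) (int a *s v) ` cube N)"
  have finS: "finite S" using finA V by (simp add: S_def)
  obtain X :: "(complex ^ 'n) set" where X: "finite X" "X \<noteq> {}" "X \<subseteq> unit_torus"
    and parseval: "\<And>c. (\<Sum>x\<in>X. (norm (\<Sum>k\<in>S. c k * monomial_at x k))\<^sup>2) = real (card X) * (\<Sum>k\<in>S. (norm (c k))\<^sup>2)"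
    using discrete_parseval[OF finS] by blast
  define G where "G x = (\<Sum>y\<in>S. of_real (trunc N g y) * monomial_at x y)" for x
  have G: "(\<Sum>x\<in>X. (norm (G x))\<^sup>2) \<ge> real (card X) * (real N ^ CARD('n) / k\<^sup>2)"
  proof -
    have "real N ^ CARD('n) / k\<^sup>2 = (\<Sum>y\<in>(cube N :: (int ^ 'n) set). 1 / k\<^sup>2)"
      by (simp add: card_cube)
    also have "\<dots> \<le> (\<Sum>y\<in>cube N. (trunc N g y)\<^sup>2)"
      using g2 by (intro sum_mono) (simp add: trunc_def)
    also have "\<dots> \<le> (\<Sum>y\<in>S. (trunc N g y)\<^sup>2)"
      using finS by (intro sum_mono2) (auto simp: S_def)
    finally show ?thesis
      unfolding G_def parseval norm_of_real by (intro mult_left_mono) auto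
  qed
  have QG: "(\<Sum>x\<in>X. (norm (q a x))\<^sup>2 * (norm (G x))\<^sup>2) \<le> real (card X) * D a N" if "a \<in> A" for a
  proof -
    have "(norm (q a x))\<^sup>2 * (norm (G x))\<^sup>2
        = (norm (\<Sum>y\<in>S. of_real (\<Sum>v\<in>V. trunc N g (y - int a *s v)) * monomial_at x y))\<^sup>2"
      if "x \<in> X" for x
    proof -
      have "(\<Sum>y\<in>S. of_real (\<Sum>v\<in>V. trunc N g (y - int a *s v)) * monomial_at x y) = q a x * G x"
        unfolding q_def G_def
        using that X(3) finS \<open>a \<in> A\<close> by (intro fourier_trunc_shift_sum) (auto simp: S_def)
      then show ?thesis by (simp add: norm_mult power_mult_distrib)
    qed
    then have "(\<Sum>x\<in>X. (norm (q a x))\<^sup>2 * (norm (G x))\<^sup>2)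
        = (\<Sum>x\<in>X. (norm (\<Sum>y\<in>S. of_real (\<Sum>v\<in>V. trunc N g (y - int a *s v)) * monomial_at x y))\<^sup>2)"
      by (rule sum.cong[OF refl])
    also have "\<dots> = real (card X) * (\<Sum>y\<in>S. (\<Sum>v\<in>V. trunc N g (y - int a *s v))\<^sup>2)"
      unfolding parseval norm_of_real by simp
    also have "\<dots> \<le> real (card X) * D a N"
      unfolding D_def k_def by (intro mult_left_mono sum_trunc_shift_sum_square_le finS g1) simp
    finally show ?thesis .
  qed
  have "\<exists>x\<in>X. \<forall>a\<in>A. (norm (q a x))\<^sup>2 \<le> \<epsilon>"
  proof (rule ccontr)
    assume contra: "\<not> ?thesis"
    \<comment> \<open>The failing a depends on x; summing over all of A removes this
      dependence.\<close>
    have "\<epsilon> \<le> (\<Sum>a\<in>A. (norm (q a x))\<^sup>2)" if x: "x \<in> X" for x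
    proof -
      obtain a where a: "a \<in> A" "(norm (q a x))\<^sup>2 > \<epsilon>" using contra x by force
      have "(norm (q a x))\<^sup>2 \<le> (\<Sum>a\<in>A. (norm (q a x))\<^sup>2)"
        using finA a(1) by (intro member_le_sum) auto
      with a(2) show ?thesis by linarith
    qed
    then have "(\<Sum>x\<in>X. \<epsilon> * (norm (G x))\<^sup>2) \<le> (\<Sum>x\<in>X. (\<Sum>a\<in>A. (norm (q a x))\<^sup>2) * (norm (G x))\<^sup>2)"
      by (intro sum_mono mult_right_mono) auto
    also have "\<dots> = (\<Sum>a\<in>A. \<Sum>x\<in>X. (norm (q a x))\<^sup>2 * (norm (G x))\<^sup>2)"
      by (subst sum.swap) (simp add: sum_distrib_right)
    also have "\<dots> \<le> (\<Sum>a\<in>A. real (card X) * D a N)"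
      by (intro sum_mono QG)
    also have "\<dots> = real (card X) * real N ^ CARD('n) * (\<Sum>a\<in>A. D a N / real N ^ CARD('n))"
      using N(2) by (simp add: sum_distrib_left)
    also have "\<dots> < real (card X) * real N ^ CARD('n) * (\<epsilon> / k\<^sup>2)"
      using N X by (intro mult_strict_left_mono) (auto simp: card_gt_0_iff)
    also have "\<dots> = \<epsilon> * (real (card X) * (real N ^ CARD('n) / k\<^sup>2))" by simp
    also have "\<dots> \<le> \<epsilon> * (\<Sum>x\<in>X. (norm (G x))\<^sup>2)"
      using eps G by (intro mult_left_mono) auto
    finally show False by (simp add: sum_distrib_left)
  qed
  then show ?thesis using X(3) unfolding A_def q_def by blast
qed

section \<open>From almost zeros to an exact zero by compactness\<close>

lemma compact_unit_torus: "compact (unit_torus :: (complex ^ 'n) set)"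
unfolding compact_eq_bounded_closed
proof (rule conjI[rotated])
  have "closed {x :: complex ^ 'n. norm (x $ i) = 1}" for i
    by (intro closed_Collect_eq continuous_intros)
  moreover have "unit_torus = (\<Inter>i. {x :: complex ^ 'n. norm (x $ i) = 1})"
    by (auto simp: unit_torus_def)
  ultimately show "closed (unit_torus :: (complex ^ 'n) set)"
    by (metis (no_types, lifting) closed_INT)
next
  show "bounded (unit_torus :: (complex ^ 'n) set)"
  proof (rule boundedI)
    fix x :: "complex ^ 'n" assume "x \<in> unit_torus"
    then show "norm x \<le> CARD('n)"
      using L2_set_le_sum[of UNIV "\<lambda>i. norm (x $ i)"] by (simp add: norm_vec_def unit_torus_def)
  qed
qed

lemma tendsto_monomial_at:
  assumes "(s \<longlongrightarrow> x) F" "x \<in> unit_torus"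
  shows "((\<lambda>n. monomial_at (s n) k) \<longlongrightarrow> monomial_at x k) F"
  unfolding monomial_at_def
  using assms by (intro tendsto_prod tendsto_power_int tendsto_vec_nth unit_torus_nonzero)

text \<open>The T-th point handles all a up to T with tolerance 1/(T+1). At a subsequential limit,
  every fixed a is eventually in range and its value is 0 by continuity.\<close>

lemma ex_unit_torus_common_zero:
  fixes V :: "(int ^ 'n) set"
  assumes "finite V" "card V \<ge> 2" "\<And>x. f x \<in> {0, 1}" "\<And>x. hits V f 1 x = 1"
  shows "\<exists>x\<in>unit_torus. \<forall>a>0. coprime a (card V) \<longrightarrow> (\<Sum>v\<in>V. monomial_at x (int a *s v)) = 0"
proof -
  let ?q = "\<lambda>a x. \<Sum>v\<in>V. monomial_at x (int a *s v)"
  have "\<exists>x\<in>unit_torus. \<forall>a\<in>{0<..T}. coprime a (card V) \<longrightarrow> (norm (?q a x))\<^sup>2 \<le> 1 / real (Suc T)" for T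
    by (rule ex_unit_torus_almost_zero[OF assms]) auto
  then obtain s where s: "\<And>T. s T \<in> unit_torus"
    "\<And>T a. a \<in> {0<..T} \<Longrightarrow> coprime a (card V) \<Longrightarrow> (norm (?q a (s T)))\<^sup>2 \<le> 1 / real (Suc T)"
    by metis
  obtain x r where x: "x \<in> unit_torus" and r: "strict_mono r" "(s \<circ> r) \<longlonglongrightarrow> x"
    using compact_unit_torus s(1) unfolding compact_def by blast
  have "?q a x = 0" if a: "a > 0" "coprime a (card V)" for a
  proof -
    have "(\<lambda>n. (norm (?q a (s (r n))))\<^sup>2) \<longlonglongrightarrow> (norm (?q a x))\<^sup>2"
      using r(2) x by (intro tendsto_intros tendsto_monomial_at) (auto simp: o_def)
    moreover have "(\<lambda>n. (norm (?q a (s (r n))))\<^sup>2) \<longlonglongrightarrow> 0"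
    proof (rule tendsto_sandwich[OF _ _ tendsto_const])
      show "\<forall>\<^sub>F n in sequentially. (norm (?q a (s (r n))))\<^sup>2 \<le> 1 / real (Suc n)"
        using eventually_ge_at_top[of a]
      proof eventually_elim
        case (elim n)
        have n: "n \<le> r n" by (rule seq_suble[OF r(1)])
        then have "(norm (?q a (s (r n))))\<^sup>2 \<le> 1 / real (Suc (r n))"
          using elim a by (intro s(2)) auto
        also have "\<dots> \<le> 1 / real (Suc n)" using n by (simp add: frac_le)
        finally show ?case .
      qed
      show "(\<lambda>n. 1 / real (Suc n)) \<longlonglongrightarrow> 0" by (rule lim_1_over_n[THEN LIMSEQ_Suc])
    qed auto
    ultimately have "(norm (?q a x))\<^sup>2 = 0" by (rule LIMSEQ_unique)
    then show ?thesis by simp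
  qed
  with x show ?thesis by blast
qed

section \<open>Application to tilings and to Q\<close>

lemma hits_tiling:
  assumes "finite V" "is_tiling V L"
  shows "hits V (indicator L) 1 x = 1"
proof -
  have "\<exists>!(v, l). v \<in> V \<and> l \<in> L \<and> x = v + l"
    using assms(2) unfolding is_tiling_def by (rule spec)
  then obtain p where p: "case p of (v, l) \<Rightarrow> v \<in> V \<and> l \<in> L \<and> x = v + l"
    and p_unique: "\<forall>p'. (case p' of (v, l) \<Rightarrow> v \<in> V \<and> l \<in> L \<and> x = v + l) \<longrightarrow> p' = p"
    by (rule ex1E)
  obtain v l where vl: "v \<in> V" "l \<in> L" "x = v + l" "p = (v, l)"
    using p by (cases p) auto
  have uniq: "v' = v" if "v' \<in> V" "l' \<in> L" "x = v' + l'" for v' l'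
    using p_unique[rule_format, of "(v', l')"] that vl(4) by simp
  have "w \<in> V \<Longrightarrow> x - w \<in> L \<longleftrightarrow> w = v" for w
    using vl uniq[of w "x - w"] by auto
  then have "hits V (indicator L) 1 x = (\<Sum>w\<in>V. if w = v then 1 else 0)"
    unfolding hits_def by (intro sum.cong) (auto simp: indicator_def)
  then show ?thesis using assms(1) vl(1) by simp
qed

text \<open>Raising the coordinates to the power a dilates the exponents, and the negated exponents
  in Q give conjugates on the torus.\<close>

lemma Q_powi_eq:
  assumes "finite V" "x \<in> unit_torus"
  shows "Q V (\<chi> i. (x $ i) powi a) = cnj (\<Sum>v\<in>V. monomial_at x (a *s v))"
proof -
  have "Q V (\<chi> i. (x $ i) powi a) = (\<Sum>v\<in>V. monomial_at (\<chi> i. (x $ i) powi a) (- v))"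
    unfolding Q_def monomial_at_def by (subst sum.reindex) auto
  also have "\<dots> = (\<Sum>v\<in>V. cnj (monomial_at x (a *s v)))"
    using monomial_at_uminus[OF assms(2)] by (simp only: monomial_at_powi) simp
  finally show ?thesis by simp
qed

theorem theorem14:
  fixes V :: "(int ^ 'n) set"
  assumes "finite V"
    and "0 \<in> V"
    and "V \<noteq> {0}"
    and "\<exists>L. is_tiling V L"
  shows "\<exists>x :: complex ^ 'n. (\<forall>i. x $ i \<noteq> 0) \<and>
    (\<forall>a :: int. coprime a (int (card V)) \<longrightarrow> Q V (\<chi> i. (x $ i) powi a) = 0)"
proof -
  obtain L where L: "is_tiling V L" using assms(4) by blast
  \<comment> \<open>For V = {0} the polynomial is the constant 1 and has no zero.\<close>
  have "card V \<noteq> 0" "card V \<noteq> 1"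
    using assms(1-3) by (auto simp: card_1_singleton_iff)
  then have k: "card V \<ge> 2" by linarith
  obtain x where x: "x \<in> unit_torus"
    and zero: "\<And>a. a > 0 \<Longrightarrow> coprime a (card V) \<Longrightarrow> (\<Sum>v\<in>V. monomial_at x (int a *s v)) = 0"
    using ex_unit_torus_common_zero[OF assms(1) k _ hits_tiling[OF assms(1) L]]
    by (auto simp: indicator_def)
  have "Q V (\<chi> i. (x $ i) powi a) = 0" if a: "coprime a (int (card V))" for a
  proof -
    define b where "b = nat \<bar>a\<bar>"
    \<comment> \<open>Zero is coprime only to 1 among the naturals, and card V is at least
      2.\<close>
    have "a \<noteq> 0" using a k by auto
    moreover have "coprime b (card V)"
      using a by (simp add: b_def flip: coprime_int_iff)
    ultimately have b: "(\<Sum>v\<in>V. monomial_at x (int b *s v)) = 0"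
      by (intro zero) (auto simp: b_def)
    show ?thesis
    proof (cases "a \<ge> 0")
      case True
      then show ?thesis using b by (simp add: Q_powi_eq[OF assms(1) x] b_def)
    next
      case False
      \<comment> \<open>A negative a gives the conjugate of the value at |a|, which is again
        0.\<close>
      then have "a *s v = - (int b *s v)" for v :: "int ^ 'n"
        by (simp add: b_def vec_eq_iff)
      then have "(\<Sum>v\<in>V. monomial_at x (a *s v)) = cnj (\<Sum>v\<in>V. monomial_at x (int b *s v))"
        by (simp add: monomial_at_uminus[OF x])
      then show ?thesis by (simp only: Q_powi_eq[OF assms(1) x] b) simp
    qed
  qed
  with x show ?thesis using unit_torus_nonzero by blast
qed

end
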